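(* Let $T$ be a bounded linear operator on an arbitrary (not necessarily separable) complex Hilbert space $\mathcal{H}$, and let $k,n$ be positive integers. If $T$ is $k$-quasiparanormal and $T^n$ is normal, then there is an orthogonal decomposition $\mathcal{H}=\mathcal{H}_1\oplus\mathcal{H}_2$ into subspaces reducing $T$ such that $T=N\oplus L$, where $N=T|_{\mathcal{H}_1}$ is normal and $L=T|_{\mathcal{H}_2}$ is nilpotent of index at most $\min\{n,k+1\}$, i.e. $L^{\min\{n,k+1\}}=O$ (either summand may be absent).
   Context: For a positive integer $k$, $T$ is $k$-quasiparanormal if $\|T(T^kx)\|^2\le\|T^2(T^kx)\|\,\|T^kx\|$ for every $x\in\mathcal{H}$. A subspace reduces $T$ if it is invariant under $T$ and $T^*$. *)

theory Defs
  imports "HOL-Analysis.Analysis"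
begin

text \<open>HOL-Analysis only provides real inner product spaces. A complex inner product
space is modelled as a real inner product space carrying a complex scalar
multiplication and a complex (sesquilinear, conjugate-linear in the first argument)
inner product whose real part is the real inner product. In particular the norm is
the one induced by the complex inner product: norm x = sqrt (Re (cinner x x)).\<close>

class complex_inner = real_inner +
  fixes scaleC :: "complex \<Rightarrow> 'a \<Rightarrow> 'a"
    and cinner :: "'a \<Rightarrow> 'a \<Rightarrow> complex"
  assumes scaleC_add_right: "scaleC a (x + y) = scaleC a x + scaleC a y"
    and scaleC_add_left: "scaleC (a + b) x = scaleC a x + scaleC b x"
    and scaleC_scaleC: "scaleC a (scaleC b x) = scaleC (a * b) x"
    and scaleC_one: "scaleC 1 x = x"
    and scaleR_scaleC: "scaleR r x = scaleC (complex_of_real r) x"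
    and cinner_commute: "cinner x y = cnj (cinner y x)"
    and cinner_add_left: "cinner (x + y) z = cinner x z + cinner y z"
    and cinner_scaleC_left: "cinner (scaleC c x) y = cnj c * cinner x y"
    and inner_eq_Re_cinner: "inner x y = Re (cinner x y)"

class chilbert_space = complex_inner + complete_space

definition bounded_clinear :: "('a::complex_inner \<Rightarrow> 'b::complex_inner) \<Rightarrow> bool" where
  "bounded_clinear T \<longleftrightarrow> bounded_linear T \<and> (\<forall>c x. T (scaleC c x) = scaleC c (T x))"

text \<open>Hilbert-space adjoint (exists for bounded operators by the Riesz representation theorem).\<close>
definition cadjoint :: "('a::complex_inner \<Rightarrow> 'a) \<Rightarrow> ('a \<Rightarrow> 'a)" where
  "cadjoint T = (SOME S. \<forall>x y. cinner (T x) y = cinner x (S y))"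

definition closed_csubspace :: "'a::complex_inner set \<Rightarrow> bool" where
  "closed_csubspace H \<longleftrightarrow> 0 \<in> H \<and> (\<forall>x\<in>H. \<forall>y\<in>H. x + y \<in> H) \<and>
     (\<forall>c. \<forall>x\<in>H. scaleC c x \<in> H) \<and> closed H"

definition reduces :: "('a::complex_inner \<Rightarrow> 'a) \<Rightarrow> 'a set \<Rightarrow> bool" where
  "reduces T H \<longleftrightarrow> closed_csubspace H \<and> T ` H \<subseteq> H \<and> cadjoint T ` H \<subseteq> H"

text \<open>The operator T restricted to the (T-invariant closed) subspace H is normal,
regarded as an operator on the Hilbert space H: it has an adjoint on H commuting with it.\<close>
definition normal_on :: "'a::complex_inner set \<Rightarrow> ('a \<Rightarrow> 'a) \<Rightarrow> bool" where
  "normal_on H T \<longleftrightarrow> (\<exists>S. S ` H \<subseteq> H \<and>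
      (\<forall>x\<in>H. \<forall>y\<in>H. cinner (T x) y = cinner x (S y)) \<and>
      (\<forall>x\<in>H. T (S x) = S (T x)))"

definition normal_op :: "('a::complex_inner \<Rightarrow> 'a) \<Rightarrow> bool" where
  "normal_op T \<longleftrightarrow> normal_on UNIV T"

definition k_quasiparanormal :: "nat \<Rightarrow> ('a::complex_inner \<Rightarrow> 'a) \<Rightarrow> bool" where
  "k_quasiparanormal k T \<longleftrightarrow>
     (\<forall>x. (norm (T ((T ^^ k) x)))\<^sup>2 \<le> norm ((T ^^ 2) ((T ^^ k) x)) * norm ((T ^^ k) x))"

end

theory Submission
  imports Defs
begin

text \<open>Put A = T^n. Since A is normal, the kernels of A and A* agree, so H2 = ker A reduces T;
there T is nilpotent, and k-quasiparanormality reads T^(k+2) x = 0 implies T^(k+1) x = 0. On the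
orthogonal complement H1, which lies in the closure of the range of T^k, T is paranormal, so the
norms of the T^j x are log-convex in j.

For c \<ge> 0 the vectors x whose iterates A^m x grow at most like c^m form the spectral subspace
of |A| for [0, c]. It reduces T because A^m x and A*^m x have the same norm; this replaces Fuglede's
theorem. Between the levels s^n and t^n, log-convexity gives
s |x| \<le> |T x| \<le> t |x|, so T*T is within t^2 - s^2 of the scalar s^2 and almost commutes
with T. Cutting H1 into ever thinner slabs shows that T*T commutes with T on H1, and density
of the range of T then makes T normal there.\<close>

section \<open>Orthogonal projections and adjoints\<close>

text \<open>The quadratic in t is smallest at t = <v, s> / |s|^2, where it lies <v, s>^2 / |s|^2
  below |v|^2.\<close>

lemma inner_eq_0_if_norm_minimal:
  fixes v s :: "'a::real_inner"
  assumes min: "\<And>t. (norm v)\<^sup>2 \<le> (norm (v - t *\<^sub>R s))\<^sup>2"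
  shows "inner v s = 0"
proof (cases "s = 0")
  case False
  define t where "t = inner v s / (norm s)\<^sup>2"
  have "(norm (v - t *\<^sub>R s))\<^sup>2 = (norm v)\<^sup>2 - 2 * t * inner v s + t\<^sup>2 * (norm s)\<^sup>2"
    unfolding power2_norm_eq_inner
    by (simp add: inner_diff_left inner_diff_right inner_commute[of s v] power2_eq_square[of t] algebra_simps
        del: dot_square_norm)
  also have "t\<^sup>2 * (norm s)\<^sup>2 = t * inner v s"
    using False by (simp add: t_def power2_eq_square)
  finally have "t * inner v s \<le> 0"
    using min[of t] by simp
  then have "(inner v s)\<^sup>2 \<le> 0"
    using False by (simp add: t_def divide_le_0_iff flip: power2_eq_square)
  then show ?thesis by simp
qed auto

text \<open>Midpoints of points of S stay in S, so by the parallelogram law a sequence minimising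
  the distance to x is Cauchy. Its limit u is a nearest point, and the first variation makes x - u
  orthogonal to S.\<close>

lemma projection_theorem:
  fixes S :: "'a::{real_inner,banach} set"
  assumes sub: "subspace S" and cl: "closed S"
  obtains u v where "u \<in> S" "v \<in> orthogonal_comp S" "x = u + v"
proof -
  define q where "q s = (norm (x - s))\<^sup>2" for s
  define D where "D = Inf (q ` S)"
  have bdd: "bdd_below (q ` S)"
    by (rule bdd_belowI[of _ 0]) (auto simp: q_def)
  have D_le: "D \<le> q s" if "s \<in> S" for s
    unfolding D_def using bdd that by (intro cInf_lower) auto
  have "\<exists>s\<in>S. q s < D + 1 / real (Suc n)" for n
    using cInf_lessD[of "q ` S" "D + 1 / real (Suc n)"] subspace_0[OF sub]
    by (auto simp: D_def)
  then obtain y where yS: "\<And>n. y n \<in> S" and y: "\<And>n. q (y n) < D + 1 / real (Suc n)"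
    by metis
  have close: "(dist (y m) (y n))\<^sup>2 \<le> 2 / real (Suc m) + 2 / real (Suc n)" for m n
  proof -
    have "(1/2) *\<^sub>R (y m + y n) \<in> S"
      using sub yS by (intro subspace_scale subspace_add)
    from D_le[OF this] have "4 * D \<le> (norm (2 *\<^sub>R x - (y m + y n)))\<^sup>2"
    proof -
      have "2 *\<^sub>R x - (y m + y n) = 2 *\<^sub>R (x - (1/2) *\<^sub>R (y m + y n))"
        by (simp add: scaleR_diff_right)
      then have "(norm (2 *\<^sub>R x - (y m + y n)))\<^sup>2 = 4 * q ((1/2) *\<^sub>R (y m + y n))"
        unfolding q_def by (simp add: power_mult_distrib)
      then show ?thesis using \<open>D \<le> q _\<close> by simp
    qed
    moreover have "(dist (y m) (y n))\<^sup>2 + (norm (2 *\<^sub>R x - (y m + y n)))\<^sup>2 = 2 * q (y m) + 2 * q (y n)"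
      unfolding q_def dist_norm power2_norm_eq_inner
      by (simp add: inner_diff_left inner_diff_right inner_add_left inner_add_right inner_commute)
    ultimately show ?thesis using y[of m] y[of n] by simp
  qed
  have "Cauchy y"
  proof (rule metric_CauchyI)
    fix e :: real assume "e > 0"
    then obtain N where N: "1 / real (Suc N) < e\<^sup>2 / 4"
      using nat_approx_posE[of "e\<^sup>2 / 4"] by auto
    have "dist (y m) (y n) < e" if "N \<le> m" "N \<le> n" for m n
    proof -
      have "1 / real (Suc m) \<le> 1 / real (Suc N)" "1 / real (Suc n) \<le> 1 / real (Suc N)"
        using that by (auto intro!: divide_left_mono)
      then have "(dist (y m) (y n))\<^sup>2 < e\<^sup>2"
        using close[of m n] N by simp
      then show ?thesis using \<open>e > 0\<close> by (simp add: power_less_imp_less_base)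
    qed
    then show "\<exists>N. \<forall>m\<ge>N. \<forall>n\<ge>N. dist (y m) (y n) < e" by blast
  qed
  then obtain u where u: "y \<longlonglongrightarrow> u"
    using Cauchy_convergent_iff convergent_def by blast
  have "u \<in> S"
    using closed_sequentially[OF cl] yS u by blast
  have "(\<lambda>n. q (y n)) \<longlonglongrightarrow> q u"
    unfolding q_def by (intro tendsto_intros u)
  moreover have "(\<lambda>n. D + 1 / real (Suc n)) \<longlonglongrightarrow> D + 0"
    by (intro tendsto_intros LIMSEQ_Suc[OF lim_1_over_n])
  ultimately have "q u \<le> D"
    using LIMSEQ_le[of "\<lambda>n. q (y n)" "q u" "\<lambda>n. D + 1 / real (Suc n)" D] y
    by (auto intro: less_imp_le)
  have "inner (x - u) s = 0" if "s \<in> S" for s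
  proof (rule inner_eq_0_if_norm_minimal)
    fix t
    have "u + t *\<^sub>R s \<in> S"
      using sub \<open>u \<in> S\<close> that by (intro subspace_add subspace_scale)
    from D_le[OF this] \<open>q u \<le> D\<close> show "(norm (x - u))\<^sup>2 \<le> (norm (x - u - t *\<^sub>R s))\<^sup>2"
      unfolding q_def diff_diff_eq by linarith
  qed
  then have "x - u \<in> orthogonal_comp S"
    by (auto simp: orthogonal_comp_def orthogonal_def inner_commute)
  then show thesis
    using that[of u "x - u"] \<open>u \<in> S\<close> by simp
qed

lemma closed_orthogonal_comp:
  fixes S :: "'a::real_inner set"
  shows "closed (orthogonal_comp S)"
proof -
  have "orthogonal_comp S = (\<Inter>y\<in>S. {x. inner y x = 0})"
    by (auto simp: orthogonal_comp_def orthogonal_def)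
  also have "closed \<dots>"
    by (intro closed_INT ballI closed_Collect_eq continuous_intros)
  finally show ?thesis .
qed

lemma orthogonal_comp_orthogonal_comp:
  fixes S :: "'a::{real_inner,banach} set"
  assumes "subspace S" "closed S"
  shows "orthogonal_comp (orthogonal_comp S) = S"
proof
  show "orthogonal_comp (orthogonal_comp S) \<subseteq> S"
  proof
    fix x assume x: "x \<in> orthogonal_comp (orthogonal_comp S)"
    obtain u v where uv: "u \<in> S" "v \<in> orthogonal_comp S" "x = u + v"
      using projection_theorem[OF assms] .
    then have "inner v x = 0" "inner v u = 0"
      using x by (auto simp: orthogonal_comp_def orthogonal_def inner_commute)
    then have "v = 0" using uv by (simp add: inner_add_right)
    then show "x \<in> S" using uv by simp
  qed
qed (rule orthogonal_comp_subset)

text \<open>The kernel of a nonzero functional has codimension one, so the representing vector is a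
  multiple of any nonzero v orthogonal to the kernel.\<close>

lemma riesz_representation:
  fixes f :: "'a::{real_inner,banach} \<Rightarrow> real"
  assumes f: "bounded_linear f"
  obtains w where "\<And>x. f x = inner x w"
proof (cases "\<forall>x. f x = 0")
  case True
  then show thesis using that[of 0] by simp
next
  case False
  interpret f: bounded_linear f by fact
  from False obtain x where x: "f x \<noteq> 0" by blast
  have "subspace {x. f x = 0}"
    by (auto simp: subspace_def f.add f.scaleR)
  moreover have "closed {x. f x = 0}"
    by (intro closed_Collect_eq continuous_intros f.continuous_on)
  ultimately obtain u v where uv: "u \<in> {x. f x = 0}" "v \<in> orthogonal_comp {x. f x = 0}" "x = u + v"
    using projection_theorem by blast
  have fv: "f v \<noteq> 0" using uv x by (simp add: f.add)
  then have v0: "inner v v \<noteq> 0" by auto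
  have "f y = inner y ((f v / inner v v) *\<^sub>R v)" for y
  proof -
    have "f (y - (f y / f v) *\<^sub>R v) = 0"
      using fv by (simp add: f.diff f.scaleR)
    then have "inner (y - (f y / f v) *\<^sub>R v) v = 0"
      using uv(2) by (auto simp: orthogonal_comp_def orthogonal_def)
    then show ?thesis
      using fv v0 by (simp add: inner_diff_left field_simps)
  qed
  then show thesis by (rule that)
qed

text \<open>The adjoint is taken for the real inner product. For a complex-linear operator it is
  also the complex adjoint, so all the analysis can be done over the reals. Boundedness of both maps
  is included, which makes the notion symmetric.\<close>

definition adjoint_pair :: "('a::real_inner \<Rightarrow> 'a) \<Rightarrow> ('a \<Rightarrow> 'a) \<Rightarrow> bool" where
  "adjoint_pair T S \<longleftrightarrow> bounded_linear T \<and> bounded_linear S \<and> (\<forall>x y. inner (T x) y = inner x (S y))"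

lemma adjoint_pairD:
  assumes "adjoint_pair T S"
  shows "bounded_linear T" "bounded_linear S" "inner (T x) y = inner x (S y)"
    "inner (S x) y = inner x (T y)"
  using assms unfolding adjoint_pair_def by (auto simp: inner_commute)

lemma adjoint_pair_sym: "adjoint_pair T S \<Longrightarrow> adjoint_pair S T"
  unfolding adjoint_pair_def by (auto simp: inner_commute)

lemma adjoint_pair_compose:
  assumes "adjoint_pair T S" "adjoint_pair U V"
  shows "adjoint_pair (T \<circ> U) (V \<circ> S)"
  using assms unfolding adjoint_pair_def
  by (auto simp: comp_def intro: bounded_linear_compose)

lemma adjoint_pair_funpow:
  assumes "adjoint_pair T S"
  shows "adjoint_pair (T ^^ n) (S ^^ n)"
proof (induction n)
  case 0
  then show ?case by (simp add: adjoint_pair_def bounded_linear_ident id_def)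
next
  case (Suc n)
  have "adjoint_pair (T \<circ> T ^^ n) (S ^^ n \<circ> S)"
    by (rule adjoint_pair_compose[OF assms Suc])
  then show ?case by (metis funpow.simps(2) funpow_Suc_right)
qed

text \<open>Nondegeneracy of the inner product forces S to be linear, and |S x|^2 = <T (S x), x>
  passes the bound of T on to S.\<close>

lemma adjoint_pairI:
  fixes T S :: "'a::real_inner \<Rightarrow> 'a"
  assumes T: "bounded_linear T" and adj: "\<And>x y. inner (T x) y = inner x (S y)"
  shows "adjoint_pair T S"
proof -
  obtain B where B: "\<And>x. norm (T x) \<le> norm x * B" "B \<ge> 0"
    using bounded_linear.nonneg_bounded[OF T] by blast
  have eq: "a = b" if "\<And>x. inner x a = inner x b" for a b :: 'a
  proof -
    have "inner (a - b) (a - b) = 0" using that[of "a - b"] by (simp only: inner_diff_right)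
    then show ?thesis by simp
  qed
  have "bounded_linear S"
  proof (rule bounded_linear_intro)
    show "S (x + y) = S x + S y" for x y
      by (rule eq) (simp add: inner_add_right flip: adj)
    show "S (r *\<^sub>R x) = r *\<^sub>R S x" for r x
      by (rule eq) (simp flip: adj)
    show "norm (S x) \<le> norm x * B" for x
    proof (cases "S x = 0")
      case False
      have "(norm (S x))\<^sup>2 = inner (T (S x)) x"
        by (simp add: power2_norm_eq_inner adj)
      also have "\<dots> \<le> norm (T (S x)) * norm x" by (rule norm_cauchy_schwarz)
      also have "\<dots> \<le> (norm (S x) * B) * norm x"
        by (intro mult_right_mono B) auto
      finally show ?thesis using False by (simp add: power2_eq_square mult.commute)
    qed (use B(2) in auto)
  qed
  then show ?thesis using T adj by (simp add: adjoint_pair_def)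
qed

lemma adjoint_pair_exists:
  fixes T :: "'a::{real_inner,banach} \<Rightarrow> 'a"
  assumes T: "bounded_linear T"
  obtains S where "adjoint_pair T S"
proof -
  have "\<exists>w. \<forall>x. inner (T x) y = inner x w" for y
    using riesz_representation[of "\<lambda>x. inner (T x) y"] bounded_linear_inner_left_comp[OF T] by metis
  then obtain S where "\<And>x y. inner (T x) y = inner x (S y)" by metis
  then show thesis using adjoint_pairI[OF T] that by blast
qed

lemma adjoint_pair_unique: "adjoint_pair T S \<Longrightarrow> adjoint_pair T S' \<Longrightarrow> S = S'"
  unfolding adjoint_pair_def by (metis adjoint_unique)

text \<open>By polarisation, the norm of a symmetric operator is bounded by its numerical radius.
  The version on an invariant subspace W is what the slabs between two levels call for.\<close>

lemma symmetric_norm_le: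
  fixes E :: "'a::real_inner \<Rightarrow> 'a"
  assumes sub: "subspace W" and lin: "linear E"
    and sym: "\<And>x y. x \<in> W \<Longrightarrow> y \<in> W \<Longrightarrow> inner (E x) y = inner x (E y)"
    and inv: "\<And>x. x \<in> W \<Longrightarrow> E x \<in> W"
    and bnd: "\<And>x. x \<in> W \<Longrightarrow> \<bar>inner (E x) x\<bar> \<le> d * (norm x)\<^sup>2"
    and x: "x \<in> W" and d: "d \<ge> 0"
  shows "norm (E x) \<le> d * norm x"
proof (cases "E x = 0")
  case False
  \<comment> \<open>The multiple of \<open>E x\<close> with the norm of x: it attains equality in
    the Cauchy-Schwarz inequality and makes both terms of the parallelogram law equal.\<close>
  define y where "y = (norm x / norm (E x)) *\<^sub>R E x"
  have yW: "y \<in> W" unfolding y_def using sub inv x by (intro subspace_scale)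
  have "4 * inner (E x) y = inner (E (x + y)) (x + y) - inner (E (x - y)) (x - y)"
    using sym[OF x yW] by (simp add: linear_add[OF lin] linear_diff[OF lin] inner_add_left inner_add_right
        inner_diff_left inner_diff_right inner_commute)
  also have "\<dots> \<le> d * (norm (x + y))\<^sup>2 + d * (norm (x - y))\<^sup>2"
    using bnd[of "x + y"] bnd[of "x - y"] x yW sub by (auto simp: subspace_add subspace_diff)
  also have "\<dots> = 2 * d * ((norm x)\<^sup>2 + (norm y)\<^sup>2)"
    by (simp add: power2_norm_eq_inner inner_add_left inner_add_right
        inner_diff_left inner_diff_right inner_commute algebra_simps)
  also have "norm y = norm x" using False by (simp add: y_def)
  finally have "inner (E x) y \<le> d * (norm x)\<^sup>2" by simp
  moreover have "inner (E x) y = norm x * norm (E x)"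
    using False by (simp add: y_def power2_norm_eq_inner[symmetric] power2_eq_square)
  ultimately have "norm x * norm (E x) \<le> norm x * (d * norm x)"
    by (simp add: power2_eq_square mult.assoc mult.left_commute)
  moreover have "x \<noteq> 0" using False linear_0[OF lin] by auto
  ultimately show ?thesis by simp
qed (use d in auto)

section \<open>Log-convex sequences\<close>

text \<open>Log-convexity makes the ratios of consecutive terms nondecreasing. A first ratio r above
  t would give a j \<ge> r^j a 0, which outgrows t^j already along the multiples of n.\<close>

lemma log_convex_ratio_le:
  fixes a :: "nat \<Rightarrow> real"
  assumes nonneg: "\<And>j. a j \<ge> 0" and conv: "\<And>j. (a (Suc j))\<^sup>2 \<le> a (Suc (Suc j)) * a j"
    and n: "n > 0" and t: "t \<ge> 0" and growth: "\<And>j. a (n * j) \<le> K * (t ^ n) ^ j"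
  shows "a 1 \<le> t * a 0"
proof (rule ccontr)
  assume "\<not> a 1 \<le> t * a 0"
  then have gt: "a 1 > t * a 0" by simp
  have "a 0 \<noteq> 0"
  proof
    assume "a 0 = 0"
    with conv[of 0] gt show False by simp
  qed
  with nonneg[of 0] have a0: "a 0 > 0" by simp
  define r where "r = a 1 / a 0"
  have r: "r > t" using gt a0 by (simp add: r_def field_simps)
  with t have r0: "r > 0" by simp
  have step: "a j > 0 \<and> a (Suc j) \<ge> r * a j" for j
  proof (induction j)
    case 0
    then show ?case using a0 by (simp add: r_def)
  next
    case (Suc j)
    then have pos: "a (Suc j) > 0" using r0 by (smt (verit) mult_pos_pos)
    have "r * a j * a (Suc j) \<le> a (Suc j) * a (Suc j)"
      using Suc pos by (intro mult_right_mono) auto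
    also have "\<dots> \<le> a (Suc (Suc j)) * a j"
      using conv[of j] by (simp add: power2_eq_square)
    finally have "(r * a (Suc j)) * a j \<le> a (Suc (Suc j)) * a j" by (simp add: algebra_simps)
    then show ?case using Suc pos by simp
  qed
  have lower: "a j \<ge> r ^ j * a 0" for j
  proof (induction j)
    case (Suc j)
    have "r ^ Suc j * a 0 \<le> r * a j" using Suc r0 by (simp add: mult.assoc)
    also have "\<dots> \<le> a (Suc j)" using step by blast
    finally show ?case .
  qed simp
  have bound: "(r ^ n) ^ j * a 0 \<le> K * (t ^ n) ^ j" for j
    using lower[of "n * j"] growth[of j] by (simp add: power_mult)
  show False
  proof (cases "t = 0")
    case True
    then show False using bound[of 1] mult_pos_pos[OF zero_less_power[OF r0, of n] a0] n by (simp add: zero_power)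
  next
    case False
    with t have "t > 0" by simp
    define s where "s = r ^ n / t ^ n"
    have "s > 1" unfolding s_def using r \<open>t > 0\<close> n by (simp add: power_strict_mono)
    then obtain j where "K / a 0 < s ^ j" using real_arch_pow by blast
    moreover have "s ^ j * a 0 \<le> K"
      using bound[of j] \<open>t > 0\<close> by (simp add: s_def power_divide field_simps)
    ultimately show False using a0 by (simp add: field_simps)
  qed
qed

text \<open>Run backwards: if the ratio at n were below t, so would all earlier ratios be, and their
  product a n / a 0 would be below t^n.\<close>

lemma log_convex_ratio_ge:
  fixes a :: "nat \<Rightarrow> real"
  assumes nonneg: "\<And>j. a j \<ge> 0" and conv: "\<And>j. (a (Suc j))\<^sup>2 \<le> a (Suc (Suc j)) * a j"
    and n: "n > 0" and t: "t \<ge> 0" and ge: "a n \<ge> t ^ n * a 0"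
  shows "a (Suc n) \<ge> t * a n"
proof (rule ccontr)
  assume "\<not> t * a n \<le> a (Suc n)"
  then have lt: "a (Suc n) < t * a n" by simp
  have pre: "a j < t * a (j - 1)" if step: "a (Suc j) < t * a j" and "j > 0" for j
  proof -
    obtain i where j: "j = Suc i" using \<open>j > 0\<close> by (cases j) auto
    have "a j \<noteq> 0" using step nonneg[of "Suc j"] by auto
    with nonneg[of j] have aj: "a j > 0" by simp
    have conv': "(a j)\<^sup>2 \<le> a (Suc j) * a i" using conv[of i] j by simp
    have "a i \<noteq> 0" using conv' aj by auto
    with nonneg[of i] have ai: "a i > 0" by simp
    have "a j * a j < t * a j * a i"
      using conv' mult_strict_right_mono[OF step ai] by (simp add: power2_eq_square)
    then have "a j < t * a i" using aj ai by (simp add: mult.commute mult.left_commute)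
    then show ?thesis using j by simp
  qed
  have all: "a (Suc (n - i)) < t * a (n - i)" if "i \<le> n" for i
    using that
  proof (induction i)
    case (Suc i)
    then have "a (n - i) < t * a (n - i - 1)" by (intro pre) auto
    then show ?case using Suc.prems by (simp add: Suc_diff_Suc)
  qed (use lt in simp)
  then have all': "a (Suc i) < t * a i" if "i \<le> n" for i
    using that by (metis diff_diff_cancel diff_le_self)
  have "a i \<le> t ^ i * a 0" if "i \<le> n" for i
    using that
  proof (induction i)
    case (Suc i)
    then have "a (Suc i) \<le> t * a i" using all'[of i] by simp
    also have "\<dots> \<le> t * (t ^ i * a 0)" using Suc t by (intro mult_left_mono) auto
    finally show ?case by simp
  qed simp
  moreover obtain m where m: "n = Suc m" using n by (cases n) auto
  ultimately have "a m \<le> t ^ m * a 0" "a n < t * a m" using all'[of m] by auto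
  then have "a n < t * (t ^ m * a 0)"
    using t by (smt (verit) mult_left_mono)
  with ge m show False by simp
qed

section \<open>The absolute value of a self-adjoint operator\<close>

text \<open>The iteration behind the square root: its limit y solves 2 y = z + y^2, that is
(1 - y)^2 = 1 - z.\<close>
primrec sqrt_iter :: "('a::real_normed_vector \<Rightarrow>\<^sub>L 'a) \<Rightarrow> nat \<Rightarrow> ('a \<Rightarrow>\<^sub>L 'a)" where
  "sqrt_iter Z 0 = 0"
| "sqrt_iter Z (Suc k) = (1/2) *\<^sub>R (Z + (sqrt_iter Z k o\<^sub>L sqrt_iter Z k))"

text \<open>The iteration for the scalar z = 1. It increases and stays in [0, 1], and its increments
  majorise those of \<open>sqrt_iter\<close>, which yields convergence even when Z has norm
  1.\<close>

primrec sqrt_bound :: "nat \<Rightarrow> real" where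
  "sqrt_bound 0 = 0"
| "sqrt_bound (Suc k) = (1 + (sqrt_bound k)\<^sup>2) / 2"

lemma sqrt_bound_range: "0 \<le> sqrt_bound k \<and> sqrt_bound k \<le> 1"
proof (induction k)
  case (Suc k)
  then have "(sqrt_bound k)\<^sup>2 \<le> 1" by (simp add: power_le_one)
  then show ?case by simp
qed simp

lemma sqrt_bound_mono: "sqrt_bound k \<le> sqrt_bound (Suc k)"
proof -
  have "0 \<le> (1 - sqrt_bound k)\<^sup>2" by simp
  then show ?thesis by (simp add: power2_eq_square algebra_simps)
qed

lemma sqrt_iter_commute:
  assumes "Z o\<^sub>L W = W o\<^sub>L Z"
  shows "sqrt_iter Z k o\<^sub>L W = W o\<^sub>L sqrt_iter Z k"
proof (induction k)
  case (Suc k)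
  have *: "sqrt_iter Z k (W x) = W (sqrt_iter Z k x)" for x
    using arg_cong[OF Suc, of "\<lambda>f. blinfun_apply f x"] by simp
  have **: "Z (W x) = W (Z x)" for x
    using arg_cong[OF assms, of "\<lambda>f. blinfun_apply f x"] by simp
  show ?case
    by (rule blinfun_eqI) (simp add: * ** blinfun.bilinear_simps)
qed (simp add: blinfun_eqI)

lemma norm_sqrt_iter:
  assumes Z: "norm Z \<le> 1"
  shows "norm (sqrt_iter Z k) \<le> sqrt_bound k"
proof (induction k)
  case (Suc k)
  have "norm (sqrt_iter Z k o\<^sub>L sqrt_iter Z k) \<le> norm (sqrt_iter Z k) * norm (sqrt_iter Z k)"
    by (rule norm_blinfun_compose)
  also have "\<dots> \<le> sqrt_bound k * sqrt_bound k"
    using Suc sqrt_bound_range[of k] by (intro mult_mono) auto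
  finally show ?case
    using Z norm_triangle_ineq[of Z "sqrt_iter Z k o\<^sub>L sqrt_iter Z k"] by (simp add: power2_eq_square)
qed simp

lemma norm_sqrt_iter_diff:
  assumes Z: "norm Z \<le> 1"
  shows "norm (sqrt_iter Z (Suc k) - sqrt_iter Z k) \<le> sqrt_bound (Suc k) - sqrt_bound k"
proof (induction k)
  case 0
  then show ?case using Z by simp
next
  case (Suc k)
  let ?U = "sqrt_iter Z (Suc k)" and ?V = "sqrt_iter Z k"
  have "?V o\<^sub>L Z = Z o\<^sub>L ?V" by (rule sqrt_iter_commute) simp
  \<comment> \<open>V commutes with Z and hence with U, so U^2 - V^2 factors as (U - V)(U + V),
    matching the scalar identity for \<open>sqrt_bound\<close>.\<close>
  then have comm: "?V (Z x) = Z (?V x)" for x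
    by (metis blinfun_apply_blinfun_compose)
  have "sqrt_iter Z (Suc (Suc k)) - ?U = (1/2) *\<^sub>R ((?U - ?V) o\<^sub>L (?U + ?V))"
    by (rule blinfun_eqI) (simp add: blinfun.bilinear_simps comm algebra_simps)
  then have "norm (sqrt_iter Z (Suc (Suc k)) - ?U) \<le> 1/2 * (norm (?U - ?V) * norm (?U + ?V))"
    using norm_blinfun_compose[of "?U - ?V" "?U + ?V"] by simp
  also have "\<dots> \<le> 1/2 * ((sqrt_bound (Suc k) - sqrt_bound k) * (sqrt_bound (Suc k) + sqrt_bound k))"
    using Suc norm_sqrt_iter[OF Z, of k] norm_sqrt_iter[OF Z, of "Suc k"] norm_triangle_ineq[of ?U ?V]
      sqrt_bound_mono[of k]
    by (intro mult_left_mono mult_mono) (auto simp del: sqrt_iter.simps sqrt_bound.simps)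
  also have "\<dots> = sqrt_bound (Suc (Suc k)) - sqrt_bound (Suc k)"
    by (simp add: power2_eq_square field_simps)
  finally show ?case .
qed

lemma convergent_sqrt_iter:
  fixes Z :: "'a::banach \<Rightarrow>\<^sub>L 'a"
  assumes Z: "norm Z \<le> 1"
  shows "convergent (sqrt_iter Z)"
proof -
  have "incseq sqrt_bound"
    by (rule incseq_SucI) (rule sqrt_bound_mono)
  then obtain l where "sqrt_bound \<longlonglongrightarrow> l"
    using incseq_convergent[of sqrt_bound 1] sqrt_bound_range by blast
  then have "summable (\<lambda>k. sqrt_bound (Suc k) - sqrt_bound k)"
    by (rule telescope_summable)
  then have "summable (\<lambda>k. sqrt_iter Z (Suc k) - sqrt_iter Z k)"
    by (rule summable_comparison_test') (rule norm_sqrt_iter_diff[OF Z])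
  then have "convergent (\<lambda>n. \<Sum>k<n. sqrt_iter Z (Suc k) - sqrt_iter Z k)"
    by (simp only: summable_iff_convergent)
  then show ?thesis by (simp only: sum_lessThan_telescope) simp
qed

lemma abs_inner_blinfun_le:
  fixes Y :: "'a::real_inner \<Rightarrow>\<^sub>L 'a"
  shows "\<bar>inner (Y x) x\<bar> \<le> norm Y * (norm x)\<^sup>2"
proof -
  have "\<bar>inner (Y x) x\<bar> \<le> norm (Y x) * norm x" by (rule Cauchy_Schwarz_ineq2)
  also have "\<dots> \<le> (norm Y * norm x) * norm x" by (intro mult_right_mono norm_blinfun) auto
  finally show ?thesis by (simp add: power2_eq_square mult.assoc)
qed

text \<open>R is |X|, built as b (1 - Y) with (1 - Y)^2 = X^2 / b^2. The iterates converging to Y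
  are polynomials in X^2, so whatever commutes with X commutes with R.\<close>

lemma abs_operator_exists:
  fixes X :: "'a::{real_inner,banach} \<Rightarrow> 'a"
  assumes X: "adjoint_pair X X"
  obtains R where "adjoint_pair R R" "\<And>x. inner (R x) x \<ge> 0" "\<And>x. R (R x) = X (X x)"
    "\<And>W x. bounded_linear W \<Longrightarrow> (\<And>x. X (W x) = W (X x)) \<Longrightarrow> R (W x) = W (R x)"
proof -
  have bX: "bounded_linear X" and sX: "\<And>x y. inner (X x) y = inner x (X y)"
    using adjoint_pairD[OF X] by auto
  obtain b where b: "b > 0" "\<And>x. norm (X x) \<le> norm x * b"
    using bounded_linear.pos_bounded[OF bX] by blast
  \<comment> \<open>As b bounds the norm of X, the quadratic form of E lies between 0 and |x|^2, so
    that E has norm at most 1 and can serve as z in the iteration.\<close>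
  define E where "E x = x - (1 / b\<^sup>2) *\<^sub>R X (X x)" for x
  have bE: "bounded_linear E"
    unfolding E_def by (intro bounded_linear_intros bX bounded_linear_compose[OF bX bX, unfolded comp_def])
  have sE: "inner (E x) y = inner x (E y)" for x y
    by (simp add: E_def inner_diff_left inner_diff_right sX)
  have EE: "inner (E x) x = (norm x)\<^sup>2 - (norm (X x))\<^sup>2 / b\<^sup>2" for x
    by (simp add: E_def inner_diff_left sX power2_norm_eq_inner)
  have Xb: "(norm (X x))\<^sup>2 / b\<^sup>2 \<le> (norm x)\<^sup>2" for x
    using power_mono[OF b(2)[of x], of 2] b(1) by (simp add: power_mult_distrib field_simps)
  have nE: "norm (E x) \<le> 1 * norm x" for x
  proof (rule symmetric_norm_le[of UNIV])
    show "\<bar>inner (E x) x\<bar> \<le> 1 * (norm x)\<^sup>2" for x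
      using Xb[of x] by (simp add: EE)
  qed (auto simp: sE bounded_linear.linear[OF bE])
  define Z where "Z = Blinfun E"
  have Zap: "blinfun_apply Z = E" unfolding Z_def by (rule bounded_linear_Blinfun_apply[OF bE])
  have nZ: "norm Z \<le> 1" using nE by (intro norm_blinfun_bound) (auto simp: Zap)
  obtain Y where Y: "sqrt_iter Z \<longlonglongrightarrow> Y"
    using convergent_sqrt_iter[OF nZ] by (auto simp: convergent_def)
  have Yap: "(\<lambda>k. sqrt_iter Z k x) \<longlonglongrightarrow> Y x" for x
    by (intro tendsto_intros Y)
  have "(\<lambda>k. sqrt_iter Z (Suc k)) \<longlonglongrightarrow> (1/2) *\<^sub>R (Z + (Y o\<^sub>L Y))"
    unfolding sqrt_iter.simps
    by (intro tendsto_intros Y bounded_bilinear.tendsto[OF bounded_bilinear_blinfun_compose])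
  with LIMSEQ_Suc[OF Y] have Yeq: "Y = (1/2) *\<^sub>R (Z + (Y o\<^sub>L Y))"
    using LIMSEQ_unique by blast
  have Yeq': "2 *\<^sub>R Y x = E x + Y (Y x)" for x
    using arg_cong[OF Yeq, of "\<lambda>f. 2 *\<^sub>R blinfun_apply f x"] by (simp add: blinfun.bilinear_simps Zap)
  have nY: "norm Y \<le> 1"
  proof (rule LIMSEQ_le_const2[OF tendsto_norm[OF Y]])
    show "\<exists>N. \<forall>n\<ge>N. norm (sqrt_iter Z n) \<le> 1"
      using norm_sqrt_iter[OF nZ] sqrt_bound_range order_trans by blast
  qed
  have "inner (sqrt_iter Z k x) y = inner x (sqrt_iter Z k y)" for k x y
    by (induction k arbitrary: x y)
      (auto simp: blinfun.bilinear_simps Zap sE inner_add_left inner_add_right)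
  then have sY: "inner (Y x) y = inner x (Y y)" for x y
    using LIMSEQ_unique[OF tendsto_inner[OF Yap[of x] tendsto_const[of y]]]
      tendsto_inner[OF tendsto_const[of x] Yap[of y]] by simp
  define R where "R x = b *\<^sub>R (x - Y x)" for x
  show thesis
  proof (rule that)
    show "adjoint_pair R R"
      unfolding adjoint_pair_def R_def
      by (auto intro!: bounded_linear_intros simp: inner_diff_left inner_diff_right sY)
    show "inner (R x) x \<ge> 0" for x
    proof -
      have "inner (Y x) x \<le> 1 * (norm x)\<^sup>2"
        using abs_inner_blinfun_le[of Y x] mult_right_mono[OF nY, of "(norm x)\<^sup>2"] by simp
      then show ?thesis using b(1) by (simp add: R_def inner_diff_left power2_norm_eq_inner)
    qed
    show "R (R x) = X (X x)" for x
    proof -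
      have "R (R x) = b\<^sup>2 *\<^sub>R (x - 2 *\<^sub>R Y x + Y (Y x))"
        by (simp add: R_def blinfun.bilinear_simps algebra_simps power2_eq_square scaleR_2)
      also have "\<dots> = b\<^sup>2 *\<^sub>R (x - E x)" by (simp add: Yeq')
      also have "\<dots> = X (X x)" using b(1) by (simp add: E_def)
      finally show ?thesis .
    qed
    fix W x assume W: "bounded_linear W" and comm: "\<And>x. X (W x) = W (X x)"
    interpret W: bounded_linear W by fact
    have "Z o\<^sub>L Blinfun W = Blinfun W o\<^sub>L Z"
      by (rule blinfun_eqI)
        (simp add: Zap bounded_linear_Blinfun_apply[OF W] E_def W.diff W.scaleR comm)
    from sqrt_iter_commute[OF this] have "sqrt_iter Z k (W x) = W (sqrt_iter Z k x)" for k
      by (metis blinfun_apply_blinfun_compose bounded_linear_Blinfun_apply[OF W])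
    then have "Y (W x) = W (Y x)"
      using LIMSEQ_unique[OF Yap[of "W x"]] W.tendsto[OF Yap[of x]] by simp
    then show "R (W x) = W (R x)" by (simp add: R_def W.diff W.scaleR)
  qed
qed

section \<open>Growth subspaces of a normal operator\<close>

lemma funpow_commute_left:
  assumes "\<And>x. f (g x) = g (f x)"
  shows "(f ^^ m) (g x) = g ((f ^^ m) x)"
  by (induction m) (simp_all add: assms)

lemma bounded_linear_funpow:
  fixes T :: "'a::real_normed_vector \<Rightarrow> 'a"
  assumes "bounded_linear T"
  shows "bounded_linear (T ^^ n)"
proof (induction n)
  case (Suc n)
  then show ?case using bounded_linear_compose[OF assms Suc] by (simp add: comp_def)
qed (simp add: id_def bounded_linear_ident)

lemma orthogonal_comp_invariant:
  assumes adj: "adjoint_pair T S" and inv: "\<And>x. x \<in> M \<Longrightarrow> S x \<in> M" and x: "x \<in> orthogonal_comp M"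
  shows "T x \<in> orthogonal_comp M"
  using inv x by (auto simp: orthogonal_comp_def orthogonal_def simp flip: adjoint_pairD(4)[OF adj])

text \<open>The constant K may depend on x, which makes linearity and invariance under commuting
  operators immediate. For normal A and c \<ge> 0 it can be taken as |x|, which makes the set
  closed.\<close>

definition growth :: "('a::real_normed_vector \<Rightarrow> 'a) \<Rightarrow> real \<Rightarrow> 'a set" where
  "growth A c = {x. \<exists>K. \<forall>m. norm ((A ^^ m) x) \<le> K * c ^ m}"

lemma growth_invariant:
  assumes W: "bounded_linear W" and comm: "\<And>x. A (W x) = W (A x)" and x: "x \<in> growth A c"
  shows "W x \<in> growth A c"
proof -
  obtain B where B: "\<And>x. norm (W x) \<le> norm x * B" "B \<ge> 0"
    using bounded_linear.nonneg_bounded[OF W] by blast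
  obtain K where K: "\<And>m. norm ((A ^^ m) x) \<le> K * c ^ m"
    using x by (auto simp: growth_def)
  have "norm ((A ^^ m) (W x)) \<le> (K * B) * c ^ m" for m
  proof -
    have "norm ((A ^^ m) (W x)) = norm (W ((A ^^ m) x))"
      using comm by (simp add: funpow_commute_left)
    also have "\<dots> \<le> norm ((A ^^ m) x) * B" by (rule B)
    also have "\<dots> \<le> (K * c ^ m) * B" by (intro mult_right_mono K B)
    finally show ?thesis by (simp add: mult_ac)
  qed
  then show ?thesis by (auto simp: growth_def)
qed

lemma subspace_growth:
  assumes A: "bounded_linear A"
  shows "subspace (growth A c)"
  unfolding subspace_def
proof (intro conjI ballI allI)
  have lin: "bounded_linear (A ^^ m)" for m by (rule bounded_linear_funpow[OF A])
  show "0 \<in> growth A c"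
    using linear_0[OF bounded_linear.linear[OF lin]] by (auto simp: growth_def intro!: exI[of _ 0])
  fix x y assume "x \<in> growth A c" "y \<in> growth A c"
  then obtain K L where KL: "\<And>m. norm ((A ^^ m) x) \<le> K * c ^ m" "\<And>m. norm ((A ^^ m) y) \<le> L * c ^ m"
    by (auto simp: growth_def)
  have "norm ((A ^^ m) (x + y)) \<le> (K + L) * c ^ m" for m
    using KL[of m] norm_triangle_ineq[of "(A ^^ m) x" "(A ^^ m) y"]
    by (simp add: linear_add[OF bounded_linear.linear[OF lin]] distrib_right)
  then show "x + y \<in> growth A c" by (auto simp: growth_def)
next
  fix r x assume "x \<in> growth A c"
  then show "r *\<^sub>R x \<in> growth A c"
    by (intro growth_invariant[of "\<lambda>x. r *\<^sub>R x"] bounded_linear_scaleR_right)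
      (simp add: linear_scale[OF bounded_linear.linear[OF A]])
qed

locale normal_pair =
  fixes A A' :: "'a::{real_inner,banach} \<Rightarrow> 'a"
  assumes adj: "adjoint_pair A A'" and normal: "A (A' x) = A' (A x)"
begin

lemma bounded_linear: "bounded_linear A" "bounded_linear A'"
  using adjoint_pairD[OF adj] by auto

text \<open>A^m and A'^m commute, so both squared norms equal <A'^m (A^m x), x>.\<close>

lemma norm_funpow_adjoint: "norm ((A' ^^ m) x) = norm ((A ^^ m) x)"
proof -
  note adj_m = adjoint_pair_funpow[OF adj, of m]
  have *: "(A ^^ m) ((A' ^^ m) y) = (A' ^^ m) ((A ^^ m) y)" for y
    by (intro funpow_commute_left) (metis funpow_commute_left normal)
  have "inner ((A' ^^ m) x) ((A' ^^ m) x) = inner ((A ^^ m) x) ((A ^^ m) x)"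
    using adjoint_pairD(3)[OF adj_m] adjoint_pairD(4)[OF adj_m] * by metis
  then show ?thesis by (simp add: norm_eq)
qed

lemma norm_adjoint: "norm (A' x) = norm (A x)"
  using norm_funpow_adjoint[of 1] by simp

lemma growth_adjoint: "growth A' c = growth A c"
  by (simp add: growth_def norm_funpow_adjoint)

lemma log_convex: "(norm (A x))\<^sup>2 \<le> norm (A (A x)) * norm x"
proof -
  have "(norm (A x))\<^sup>2 = inner (A' (A x)) x"
    by (simp add: power2_norm_eq_inner adjoint_pairD(4)[OF adj])
  also have "\<dots> \<le> norm (A' (A x)) * norm x" by (rule norm_cauchy_schwarz)
  finally show ?thesis by (simp add: norm_adjoint)
qed

lemma growth_norm_le:
  assumes x: "x \<in> growth A c" and c: "c \<ge> 0"
  shows "norm (A x) \<le> c * norm x"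
proof -
  obtain K where K: "\<And>m. norm ((A ^^ m) x) \<le> K * c ^ m"
    using x by (auto simp: growth_def)
  show ?thesis
    using log_convex_ratio_le[of "\<lambda>j. norm ((A ^^ j) x)" 1 c K] c K log_convex by simp
qed

text \<open>The one-step bound \<open>growth_norm_le\<close> can be iterated because A leaves the
  set invariant; this removes the unspecified constant K.\<close>

lemma growth_eq:
  assumes c: "c \<ge> 0"
  shows "growth A c = {x. \<forall>m. norm ((A ^^ m) x) \<le> c ^ m * norm x}"
proof (intro equalityI subsetI CollectI allI)
  fix x m assume x: "x \<in> growth A c"
  show "norm ((A ^^ m) x) \<le> c ^ m * norm x"
  proof (induction m)
    case (Suc m)
    have "(A ^^ m) x \<in> growth A c"
      using growth_invariant[OF bounded_linear_funpow[OF bounded_linear(1)] _ x]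
      by (simp add: funpow_swap1)
    from growth_norm_le[OF this c] show ?case
      using mult_left_mono[OF Suc c] by (simp add: mult.assoc)
  qed simp
next
  fix x assume "x \<in> {x. \<forall>m. norm ((A ^^ m) x) \<le> c ^ m * norm x}"
  then show "x \<in> growth A c"
    by (auto simp: growth_def mult.commute)
qed

lemma closed_growth: "c \<ge> 0 \<Longrightarrow> closed (growth A c)"
  unfolding growth_eq
  by (intro closed_Collect_all closed_Collect_le continuous_intros
      linear_continuous_on[OF bounded_linear_funpow[OF bounded_linear(1)]])

text \<open>With X = A'A - c^2 and R = |X|, the range of R - X lies in the kernel of R + X, where A'A
is at most c^2. So R - X vanishes on the orthogonal complement, which makes X positive there.\<close>
lemma growth_complement_norm_ge:
  assumes x: "x \<in> orthogonal_comp (growth A c)" and c: "c \<ge> 0"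
  shows "norm (A x) \<ge> c * norm x"
proof -
  note A = bounded_linear.linear[OF bounded_linear(1)] and A' = bounded_linear.linear[OF bounded_linear(2)]
  define X where "X y = A' (A y) - c\<^sup>2 *\<^sub>R y" for y
  have "bounded_linear X"
    unfolding X_def by (intro bounded_linear_intros bounded_linear_compose[OF bounded_linear(2,1)])
  then have X: "adjoint_pair X X"
    by (rule adjoint_pairI) (simp add: X_def inner_diff_left inner_diff_right
        adjoint_pairD(3)[OF adj] adjoint_pairD(3)[OF adjoint_pair_sym[OF adj]])
  have XX: "inner (X y) y = (norm (A y))\<^sup>2 - c\<^sup>2 * (norm y)\<^sup>2" for y
    by (simp add: X_def inner_diff_left adjoint_pairD(4)[OF adj] power2_norm_eq_inner)
  have XA: "X (A y) = A (X y)" for y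
    by (simp add: X_def linear_diff[OF A] linear_scale[OF A] normal)
  from X obtain R where R: "adjoint_pair R R" and pos: "\<And>y. inner (R y) y \<ge> 0"
    and RR: "\<And>y. R (R y) = X (X y)"
    and Rcomm: "\<And>W y. bounded_linear W \<Longrightarrow> (\<And>y. X (W y) = W (X y)) \<Longrightarrow> R (W y) = W (R y)"
    by (rule abs_operator_exists) blast
  have RX: "R (X y) = X (R y)" for y
    by (rule Rcomm) (simp_all add: adjoint_pairD[OF X])
  have RA: "R (A y) = A (R y)" for y
    by (rule Rcomm) (simp_all add: bounded_linear XA)
  note lX = bounded_linear.linear[OF adjoint_pairD(1)[OF X]]
  note lR = bounded_linear.linear[OF adjoint_pairD(1)[OF R]]
  have le: "norm (A (R y - X y)) \<le> c * norm (R y - X y)" for y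
  proof -
    define w where "w = R y - X y"
    have "X w = - R w"
      unfolding w_def by (simp add: linear_diff[OF lX] linear_diff[OF lR] RR RX)
    then have "inner (X w) w \<le> 0" using pos[of w] by simp
    then have "(norm (A w))\<^sup>2 \<le> (c * norm w)\<^sup>2" by (simp add: XX power_mult_distrib)
    then show ?thesis unfolding w_def[symmetric] by (rule power2_le_imp_le) (simp add: c)
  qed
  \<comment> \<open>R - X commutes with A, so every iterate of R y - X y is again of this shape and
    \<open>le\<close> applies at each step.\<close>
  have iter: "(A ^^ m) (R y - X y) = R ((A ^^ m) y) - X ((A ^^ m) y)" for m y
    by (induction m) (simp_all add: linear_diff[OF A] XA RA)
  have mem: "R y - X y \<in> growth A c" for y
  proof -
    have "norm ((A ^^ m) (R y - X y)) \<le> norm (R y - X y) * c ^ m" for m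
    proof (induction m)
      case (Suc m)
      have "norm ((A ^^ Suc m) (R y - X y)) \<le> c * norm ((A ^^ m) (R y - X y))"
        using le[of "(A ^^ m) y"] by (simp add: iter)
      also have "\<dots> \<le> c * (norm (R y - X y) * c ^ m)" by (intro mult_left_mono Suc c)
      finally show ?case by (simp add: mult_ac)
    qed simp
    then show ?thesis by (auto simp: growth_def)
  qed
  \<comment> \<open>R - X is self-adjoint, so its squared norm at x pairs x with a vector of the
    growth subspace.\<close>
  have "inner (R x - X x) (R x - X x) = inner (R (R x - X x) - X (R x - X x)) x"
    by (simp add: inner_diff_left inner_diff_right adjoint_pairD(3)[OF X] adjoint_pairD(3)[OF R])
  also have "\<dots> = 0"
    using mem[of "R x - X x"] x by (auto simp: orthogonal_comp_def orthogonal_def)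
  finally have "R x = X x" by simp
  then have "(c * norm x)\<^sup>2 \<le> (norm (A x))\<^sup>2"
    using pos[of x] by (simp add: XX power_mult_distrib)
  then show ?thesis by (rule power2_le_imp_le) simp
qed

end

section \<open>Closures, kernels and dense ranges\<close>

lemma bounded_linear_norm_le:
  assumes "bounded_linear T"
  obtains b where "b \<ge> 0" "\<And>x. norm (T x) \<le> b * norm x"
  using bounded_linear.nonneg_bounded[OF assms] by (metis mult.commute)

lemma orthogonal_comp_closure:
  fixes W :: "'a::real_inner set"
  shows "orthogonal_comp (closure W) = orthogonal_comp W"
proof
  show "orthogonal_comp W \<subseteq> orthogonal_comp (closure W)"
  proof
    fix v assume v: "v \<in> orthogonal_comp W"
    have "closed {y. inner y v = 0}"
      by (intro closed_Collect_eq continuous_intros)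
    then have "closure W \<subseteq> {y. inner y v = 0}"
      using v by (intro closure_minimal) (auto simp: orthogonal_comp_def orthogonal_def)
    then show "v \<in> orthogonal_comp (closure W)"
      by (auto simp: orthogonal_comp_def orthogonal_def)
  qed
qed (intro orthogonal_comp_anti_mono closure_subset)

lemma subspace_closure:
  fixes W :: "'a::real_normed_vector set"
  assumes "subspace W"
  shows "subspace (closure W)"
  unfolding subspace_def
proof (intro conjI ballI allI)
  show "0 \<in> closure W"
    using subspace_0[OF assms] closure_subset by blast
  fix x assume "x \<in> closure W"
  then obtain X where X: "\<And>i. X i \<in> W" "X \<longlonglongrightarrow> x" by (auto simp: closure_sequential)
  show "r *\<^sub>R x \<in> closure W" for r
    unfolding closure_sequential
    by (intro exI[of _ "\<lambda>i. r *\<^sub>R X i"] conjI allI subspace_scale assms X tendsto_intros)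
  fix y assume "y \<in> closure W"
  then obtain Y where Y: "\<And>i. Y i \<in> W" "Y \<longlonglongrightarrow> y" by (auto simp: closure_sequential)
  show "x + y \<in> closure W"
    unfolding closure_sequential
    by (intro exI[of _ "\<lambda>i. X i + Y i"] conjI allI subspace_add assms X Y tendsto_intros)
qed

lemma closure_eq_orthogonal_comp:
  fixes W :: "'a::{real_inner,banach} set"
  assumes "subspace W"
  shows "closure W = orthogonal_comp (orthogonal_comp W)"
  using orthogonal_comp_orthogonal_comp[of "closure W"] assms
  by (simp add: orthogonal_comp_closure subspace_closure)

text \<open>Log-convexity turns A (A y) = 0 into A y = 0, which peels off one power at a
  time.\<close>

lemma (in normal_pair) funpow_eq_0:
  assumes "(A ^^ m) x = 0"
  shows "A x = 0"
  using assms
proof (induction m)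
  case 0
  then show ?case using linear_0[OF bounded_linear.linear[OF bounded_linear(1)]] by simp
next
  case (Suc m)
  show ?case
  proof (cases m)
    case (Suc l)
    then have "A (A ((A ^^ l) x)) = 0" using Suc.prems by simp
    then have "(A ^^ m) x = 0" using log_convex[of "(A ^^ l) x"] Suc by simp
    then show ?thesis by (rule Suc.IH)
  qed (use Suc.prems in simp)
qed

text \<open>Because 0 ^ 0 = 1, the growth condition with constant |x| is trivial at m = 0, and at m
  = 1 it says A x = 0.\<close>

lemma (in normal_pair) growth_zero: "growth A 0 = {x. A x = 0}"
proof -
  have "norm ((A ^^ m) x) \<le> 0 ^ m * norm x" if "A x = 0" for m x
    using that linear_0[OF bounded_linear.linear[OF bounded_linear_funpow[OF bounded_linear(1)]]]
    by (cases m) (simp_all add: funpow_swap1)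
  moreover have "A x = 0" if "\<forall>m. norm ((A ^^ m) x) \<le> 0 ^ m * norm x" for x
    using that[rule_format, of 1] by simp
  ultimately show ?thesis by (auto simp: growth_eq)
qed

lemma (in normal_pair) growth_mono:
  assumes "0 \<le> c" "c \<le> d"
  shows "growth A c \<subseteq> growth A d"
proof
  fix x assume x: "x \<in> growth A c"
  have "norm ((A ^^ m) x) \<le> d ^ m * norm x" for m
  proof -
    have "norm ((A ^^ m) x) \<le> c ^ m * norm x" using x assms by (simp add: growth_eq)
    also have "\<dots> \<le> d ^ m * norm x" using assms by (intro mult_right_mono power_mono) auto
    finally show ?thesis .
  qed
  then show "x \<in> growth A d" using assms by (simp add: growth_eq)
qed

text \<open>A vector orthogonal to the range of A^m lies in the kernel of A'^m, which by normality
  lies in the kernel of A; taking complements twice gives the closure.\<close>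

lemma (in normal_pair) complement_kernel_subset_closure_range:
  "orthogonal_comp (growth A 0) \<subseteq> closure (range (A ^^ m))"
proof -
  note adj_m = adjoint_pair_funpow[OF adj, of m]
  have "orthogonal_comp (range (A ^^ m)) \<subseteq> growth A 0"
  proof
    fix v assume "v \<in> orthogonal_comp (range (A ^^ m))"
    then have "inner ((A ^^ m) ((A' ^^ m) v)) v = 0"
      by (auto simp: orthogonal_comp_def orthogonal_def)
    then have "(A' ^^ m) v = 0" by (simp add: adjoint_pairD(3)[OF adj_m])
    then have "(A ^^ m) v = 0" using norm_funpow_adjoint[of m v] by simp
    then show "v \<in> growth A 0" by (simp add: growth_zero funpow_eq_0)
  qed
  moreover have "subspace (range (A ^^ m))"
    by (intro linear_subspace_image bounded_linear.linear adjoint_pairD(1)[OF adj_m]) simp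
  ultimately show ?thesis
    by (simp add: closure_eq_orthogonal_comp orthogonal_comp_anti_mono)
qed

section \<open>Quasiparanormal roots of normal operators\<close>

text \<open>The part of the hypotheses on T that is independent of the complex structure.\<close>
locale quasiparanormal_root =
  fixes T T' :: "'a::{real_inner,banach} \<Rightarrow> 'a" and n k :: nat
  assumes adjT: "adjoint_pair T T'"
    and n: "n > 0"
    and normal_power: "(T ^^ n) ((T' ^^ n) x) = (T' ^^ n) ((T ^^ n) x)"
    and quasiparanormal:
      "(norm (T ((T ^^ k) x)))\<^sup>2 \<le> norm (T (T ((T ^^ k) x))) * norm ((T ^^ k) x)"
begin

abbreviation "A \<equiv> T ^^ n"

sublocale normal_pair "T ^^ n" "T' ^^ n"
  by unfold_locales (auto intro: adjoint_pair_funpow adjT normal_power)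

section \<open>Reduction, paranormality and norm bounds on the complement of the kernel\<close>

lemma blT: "bounded_linear T" "bounded_linear T'"
  using adjoint_pairD[OF adjT] by auto

lemmas linT = blT[THEN bounded_linear.linear]

lemma growth_T: "x \<in> growth A c \<Longrightarrow> T x \<in> growth A c"
  by (rule growth_invariant[OF blT(1)]) (simp_all add: funpow_swap1)

text \<open>T' visibly commutes with \<open>T' ^^ n\<close>, not with A, so the invariance is
  obtained from the growth subspace of \<open>T' ^^ n\<close>, which is the same set.\<close>

lemma growth_T': "x \<in> growth A c \<Longrightarrow> T' x \<in> growth A c"
  unfolding growth_adjoint[symmetric]
  by (rule growth_invariant[OF blT(2)]) (simp_all add: funpow_swap1)

lemma complement_T: "x \<in> orthogonal_comp (growth A c) \<Longrightarrow> T x \<in> orthogonal_comp (growth A c)"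
  by (rule orthogonal_comp_invariant[OF adjT growth_T'])

lemma complement_T': "x \<in> orthogonal_comp (growth A c) \<Longrightarrow> T' x \<in> orthogonal_comp (growth A c)"
  by (rule orthogonal_comp_invariant[OF adjoint_pair_sym[OF adjT] growth_T])

lemma complement_funpow:
  "x \<in> orthogonal_comp (growth A c) \<Longrightarrow> (T ^^ m) x \<in> orthogonal_comp (growth A c)"
  by (induction m) (auto intro: complement_T)

text \<open>The condition is closed and holds on the range of T^k by hypothesis. That range contains
  the range of A^k, whose closure contains the complement of the kernel.\<close>

lemma paranormal:
  assumes x: "x \<in> orthogonal_comp (growth A 0)"
  shows "(norm (T x))\<^sup>2 \<le> norm (T (T x)) * norm x"
proof -
  let ?P = "{x. (norm (T x))\<^sup>2 \<le> norm (T (T x)) * norm x}"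
  have "closed ?P"
    by (intro closed_Collect_le continuous_intros linear_continuous_on blT(1)
        linear_continuous_on[OF bounded_linear_compose[OF blT(1) blT(1)]])
  moreover have "range (A ^^ k) \<subseteq> ?P"
  proof clarify
    fix z
    have "k \<le> n * k" using n by simp
    then have "(A ^^ k) z = (T ^^ k) ((T ^^ (n * k - k)) z)"
      by (metis funpow_mult funpow_add comp_apply le_add_diff_inverse)
    then show "(norm (T ((A ^^ k) z)))\<^sup>2 \<le> norm (T (T ((A ^^ k) z))) * norm ((A ^^ k) z)"
      using quasiparanormal by simp
  qed
  ultimately have "closure (range (A ^^ k)) \<subseteq> ?P" by (rule closure_minimal[rotated])
  then show ?thesis using x complement_kernel_subset_closure_range by blast
qed

text \<open>The sequence |T^j x| is log-convex, and the growth of A controls it along the multiples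
  of n.\<close>

lemma norm_T_le:
  assumes x: "x \<in> orthogonal_comp (growth A 0)" and g: "x \<in> growth A (t ^ n)" and t: "t \<ge> 0"
  shows "norm (T x) \<le> t * norm x"
proof -
  obtain K where K: "\<And>m. norm ((A ^^ m) x) \<le> K * (t ^ n) ^ m"
    using g by (auto simp: growth_def)
  show ?thesis
    using log_convex_ratio_le[of "\<lambda>j. norm ((T ^^ j) x)" n t K] n t K
      paranormal[OF complement_funpow[OF x]] by (simp add: funpow_mult)
qed

lemma complement_antimono:
  "0 \<le> c \<Longrightarrow> c \<le> d \<Longrightarrow> orthogonal_comp (growth A d) \<subseteq> orthogonal_comp (growth A c)"
  by (intro orthogonal_comp_anti_mono growth_mono)

text \<open>A respects the splitting into the growth subspace and H. The H-part h of a vector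
  orthogonal to A H is orthogonal to the whole range of A, so it lies in the kernel of A, hence in
  the growth subspace, and vanishes.\<close>

lemma complement_subset_closure:
  assumes c: "c \<ge> 0"
  defines "H \<equiv> orthogonal_comp (growth A c)"
  shows "H \<subseteq> closure (A ` H)"
proof -
  have sub: "subspace (A ` H)"
    unfolding H_def
    by (intro linear_subspace_image bounded_linear.linear bounded_linear subspace_orthogonal_comp)
  have orth: "inner m h = 0" if "m \<in> growth A c" "h \<in> H" for m h
    using that by (auto simp: H_def orthogonal_comp_def orthogonal_def)
  have split: "\<exists>m h. m \<in> growth A c \<and> h \<in> H \<and> z = m + h" for z
    using projection_theorem[OF subspace_growth[OF bounded_linear(1)] closed_growth[OF c], of z]
    unfolding H_def by metis
  have AH: "A h \<in> H" if "h \<in> H" for h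
    using that unfolding H_def by (rule complement_funpow)
  have AM: "A m \<in> growth A c" if "m \<in> growth A c" for m
    by (rule growth_invariant[OF bounded_linear(1) _ that]) simp
  have "inner v x = 0" if v: "v \<in> orthogonal_comp (A ` H)" and x: "x \<in> H" for v x
  proof -
    obtain m h where mh: "m \<in> growth A c" "h \<in> H" "v = m + h" using split by blast
    have Ah: "inner (A y) h = 0" if "y \<in> H" for y
    proof -
      have "inner (A y) v = 0" using v that by (auto simp: orthogonal_comp_def orthogonal_def)
      moreover have "inner (A y) m = 0" using orth[OF mh(1) AH[OF that]] by (simp add: inner_commute)
      ultimately show ?thesis by (simp add: mh(3) inner_add_right)
    qed
    have "inner (A z) h = 0" for z
    proof -
      obtain m' h' where z: "m' \<in> growth A c" "h' \<in> H" "z = m' + h'" using split by blast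
      then show ?thesis
        using orth[OF AM[OF z(1)] mh(2)] Ah[OF z(2)]
        by (simp add: linear_add[OF bounded_linear.linear[OF bounded_linear(1)]] inner_add_left)
    qed
    from this[of "(T' ^^ n) h"] have "(T' ^^ n) h = 0"
      by (simp add: adjoint_pairD(3)[OF adj])
    then have "A h = 0" using norm_adjoint[of h] by simp
    then have "h \<in> growth A c"
      using growth_mono[OF _ c] by (auto simp: growth_zero)
    then have "h = 0" using orth[OF _ mh(2)] by force
    then show ?thesis using orth[OF mh(1) x] mh(3) by simp
  qed
  then have "H \<subseteq> orthogonal_comp (orthogonal_comp (A ` H))"
    by (auto simp: orthogonal_comp_def orthogonal_def)
  then show ?thesis by (simp only: closure_eq_orthogonal_comp[OF sub])
qed

text \<open>Log-convexity bounds the ratio from below only after n steps, hence at vectors A z with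
  z in H; these are dense in H by \<open>complement_subset_closure\<close>.\<close>

lemma norm_T_ge:
  assumes x: "x \<in> orthogonal_comp (growth A (s ^ n))" and s: "s \<ge> 0"
  shows "norm (T x) \<ge> s * norm x"
proof -
  let ?H = "orthogonal_comp (growth A (s ^ n))"
  let ?P = "{x. s * norm x \<le> norm (T x)}"
  have "closed ?P"
    by (intro closed_Collect_le continuous_intros linear_continuous_on blT(1))
  moreover have "A ` ?H \<subseteq> ?P"
  proof clarify
    fix z assume z: "z \<in> ?H"
    have z0: "z \<in> orthogonal_comp (growth A 0)"
      using complement_antimono[of 0 "s ^ n"] s z by auto
    have "norm (A z) \<ge> s ^ n * norm z"
      using growth_complement_norm_ge[OF z] s by simp
    then show "s * norm (A z) \<le> norm (T (A z))"
      using log_convex_ratio_ge[of "\<lambda>j. norm ((T ^^ j) z)" n s] n s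
        paranormal[OF complement_funpow[OF z0]] by simp
  qed
  ultimately have "closure (A ` ?H) \<subseteq> ?P" by (rule closure_minimal[rotated])
  then show ?thesis using x complement_subset_closure[of "s ^ n"] s by auto
qed

text \<open>The commutator of T with T' T, which is small on a reducing subspace where T' T is close
  to a scalar.\<close>

definition defect :: "'a \<Rightarrow> 'a" where
  "defect x = T (T' (T x)) - T' (T (T x))"

lemma linear_defect: "linear defect"
  unfolding defect_def
  by (rule linearI) (simp_all add: linear_add[OF linT(1)] linear_add[OF linT(2)]
      linear_scale[OF linT(1)] linear_scale[OF linT(2)] scaleR_diff_right)

text \<open>On the slab W the two norm bounds put the quadratic form of E = T' T - s^2 between 0 and
  t^2 - s^2, so E is small in norm. The scalar drops out of the commutator, so E may replace T' T in
  the defect.\<close>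

lemma norm_defect_slab:
  assumes x: "x \<in> orthogonal_comp (growth A (s ^ n)) \<inter> growth A (t ^ n)"
    and st: "0 \<le> s" "s \<le> t" and b: "b \<ge> 0" "\<And>x. norm (T x) \<le> b * norm x"
  shows "norm (defect x) \<le> 2 * (t\<^sup>2 - s\<^sup>2) * b * norm x"
proof -
  define W where "W = orthogonal_comp (growth A (s ^ n)) \<inter> growth A (t ^ n)"
  define E where "E y = T' (T y) - s\<^sup>2 *\<^sub>R y" for y
  have TW: "T y \<in> W" "T' y \<in> W" if "y \<in> W" for y
    using that by (auto simp: W_def intro: complement_T complement_T' growth_T growth_T')
  have sW: "subspace W"
    unfolding W_def
    by (intro subspace_inter subspace_orthogonal_comp subspace_growth bounded_linear)
  have d: "t\<^sup>2 - s\<^sup>2 \<ge> 0" using st by (simp add: power_mono)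
  have nE: "norm (E y) \<le> (t\<^sup>2 - s\<^sup>2) * norm y" if "y \<in> W" for y
  proof (rule symmetric_norm_le[OF sW _ _ _ _ that d])
    show "linear E"
      unfolding E_def
      by (rule linearI) (simp_all add: linear_add[OF linT(1)] linear_add[OF linT(2)]
          linear_scale[OF linT(1)] linear_scale[OF linT(2)] algebra_simps)
    show "inner (E x) y = inner x (E y)" for x y
      by (simp add: E_def inner_diff_left inner_diff_right adjoint_pairD(3)[OF adjT]
          adjoint_pairD(3)[OF adjoint_pair_sym[OF adjT]])
    show "E z \<in> W" if "z \<in> W" for z
      unfolding E_def using that by (intro subspace_diff subspace_scale sW TW)
    show "\<bar>inner (E z) z\<bar> \<le> (t\<^sup>2 - s\<^sup>2) * (norm z)\<^sup>2" if z: "z \<in> W" for z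
    proof -
      have eq: "inner (E z) z = (norm (T z))\<^sup>2 - (s * norm z)\<^sup>2"
        by (simp add: E_def inner_diff_left adjoint_pairD(4)[OF adjT] power2_norm_eq_inner
            power_mult_distrib)
      have "z \<in> orthogonal_comp (growth A 0)"
        using complement_antimono[of 0 "s ^ n"] st z by (auto simp: W_def)
      then have "norm (T z) \<le> t * norm z"
        using norm_T_le z st by (auto simp: W_def)
      then have "(norm (T z))\<^sup>2 \<le> (t * norm z)\<^sup>2" by (simp add: power_mono)
      moreover have "s * norm z \<le> norm (T z)"
        using norm_T_ge z st by (auto simp: W_def)
      then have "(s * norm z)\<^sup>2 \<le> (norm (T z))\<^sup>2" using st by (simp add: power_mono)
      ultimately show ?thesis
        unfolding eq by (simp add: power_mult_distrib left_diff_distrib)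
    qed
  qed
  have xW: "x \<in> W" using x by (simp add: W_def)
  have "defect x = T (E x) - E (T x)"
    by (simp add: defect_def E_def linear_diff[OF linT(1)] linear_scale[OF linT(1)])
  then have "norm (defect x) \<le> norm (T (E x)) + norm (E (T x))" by (simp add: norm_triangle_ineq4)
  also have "norm (T (E x)) \<le> b * ((t\<^sup>2 - s\<^sup>2) * norm x)"
    using b(2)[of "E x"] mult_left_mono[OF nE[OF xW] b(1)] by simp
  also have "norm (E (T x)) \<le> (t\<^sup>2 - s\<^sup>2) * (b * norm x)"
    using nE[OF TW(1)[OF xW]] mult_left_mono[OF b(2)[of x] d] by simp
  finally show ?thesis by (simp add: algebra_simps)
qed

text \<open>The slabs between consecutive levels are mutually orthogonal and reduce T, so the norm of
the defect on their span is the largest of its norms on the slabs.\<close>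
lemma norm_defect_levels:
  assumes b: "b \<ge> 0" "\<And>x. norm (T x) \<le> b * norm x" and d: "d > 0"
    and x: "x \<in> orthogonal_comp (growth A 0)" "x \<in> growth A (sqrt (real i * d) ^ n)"
  shows "norm (defect x) \<le> 2 * d * b * norm x"
  using x
proof (induction i arbitrary: x)
  case 0
  \<comment> \<open>\<open>0 ^ n = 0\<close> as n > 0, so x lies both in the kernel of A and in its
    orthogonal complement.\<close>
  then have "x \<in> growth A 0" using n by (simp add: zero_power)
  with 0 have "x = 0" by (auto simp: orthogonal_comp_def orthogonal_def)
  then show ?case by (simp add: linear_0[OF linear_defect])
next
  case (Suc i)
  \<comment> \<open>Levels at the square roots of multiples of d give every slab t^2 - s^2 = d,
    whatever i is.\<close>
  define s t where "s = sqrt (real i * d)" and "t = sqrt (real (Suc i) * d)"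
  have st: "0 \<le> s" "s \<le> t" using d by (auto simp: s_def t_def)
  have td: "t\<^sup>2 - s\<^sup>2 = d" using d by (simp add: s_def t_def algebra_simps)
  let ?M = "growth A (s ^ n)"
  have sub: "subspace (growth A c)" for c by (intro subspace_growth bounded_linear)
  have "closed ?M" using st by (intro closed_growth) simp
  then obtain u v where uv: "u \<in> ?M" "v \<in> orthogonal_comp ?M" "x = u + v"
    using projection_theorem[OF sub] by blast
  have v0: "v \<in> orthogonal_comp (growth A 0)"
    using complement_antimono[of 0 "s ^ n"] st uv by auto
  then have u0: "u \<in> orthogonal_comp (growth A 0)"
    using subspace_diff[OF subspace_orthogonal_comp Suc.prems(1) v0] uv by simp
  have "u \<in> growth A (t ^ n)"
    using growth_mono[of "s ^ n" "t ^ n"] st uv by (auto simp: power_mono)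
  then have vt: "v \<in> growth A (t ^ n)"
    using subspace_diff[OF sub Suc.prems(2), of u] uv by (simp add: t_def)
  have Cu: "norm (defect u) \<le> 2 * d * b * norm u"
    using Suc.IH[OF u0] uv by (simp add: s_def)
  have Cv: "norm (defect v) \<le> 2 * d * b * norm v"
    using norm_defect_slab[OF _ st b, of v] uv vt by (simp add: td)
  have "defect u \<in> ?M" "defect v \<in> orthogonal_comp ?M"
    using uv unfolding defect_def
    by (auto intro!: subspace_diff sub subspace_orthogonal_comp growth_T growth_T' complement_T complement_T')
  then have "inner (defect u) (defect v) = 0" "inner u v = 0"
    using uv by (auto simp: orthogonal_comp_def orthogonal_def)
  then have "(norm (defect x))\<^sup>2 = (norm (defect u))\<^sup>2 + (norm (defect v))\<^sup>2"
    "(norm x)\<^sup>2 = (norm u)\<^sup>2 + (norm v)\<^sup>2"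
    by (simp_all add: uv(3) linear_add[OF linear_defect] norm_add_Pythagorean orthogonal_def)
  moreover have "(norm (defect u))\<^sup>2 \<le> (2 * d * b * norm u)\<^sup>2"
    "(norm (defect v))\<^sup>2 \<le> (2 * d * b * norm v)\<^sup>2"
    using Cu Cv by (simp_all add: power_mono)
  ultimately have "(norm (defect x))\<^sup>2 \<le> (2 * d * b * norm x)\<^sup>2"
    by (simp add: power_mult_distrib distrib_left)
  then show ?case by (rule power2_le_imp_le) (use b d in simp)
qed

text \<open>For every mesh d the vector x lies below some level, and the bound on the defect does
  not involve the number of levels, so d can tend to 0.\<close>

lemma defect_eq_0:
  assumes x: "x \<in> orthogonal_comp (growth A 0)"
  shows "defect x = 0"
proof -
  obtain b where b: "b \<ge> 0" "\<And>x. norm (T x) \<le> b * norm x"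
    using bounded_linear_norm_le[OF blT(1)] by blast
  have Tm: "norm ((T ^^ m) x) \<le> b ^ m * norm x" for m
  proof (induction m)
    case (Suc m)
    then show ?case
      using b(2)[of "(T ^^ m) x"] mult_left_mono[OF Suc b(1)] by (simp add: mult.assoc)
  qed simp
  have bound: "norm (defect x) \<le> d * (2 * b * norm x)" if d: "d > 0" for d
  proof -
    obtain i where "b\<^sup>2 / d \<le> real i" using real_arch_simple by blast
    then have "b\<^sup>2 \<le> real i * d" using d by (simp add: field_simps)
    then have le: "b \<le> sqrt (real i * d)" by (rule real_le_rsqrt)
    have "norm ((A ^^ m) x) \<le> norm x * (b ^ n) ^ m" for m
      using Tm[of "n * m"] by (simp add: funpow_mult mult.commute[of "norm x"] flip: power_mult)
    then have "x \<in> growth A (b ^ n)" by (auto simp: growth_def)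
    then have "x \<in> growth A (sqrt (real i * d) ^ n)"
      using growth_mono[of "b ^ n" "sqrt (real i * d) ^ n"] b(1) le by (auto simp: power_mono)
    from norm_defect_levels[OF b d x this] show ?thesis by (simp add: mult_ac)
  qed
  have "norm (defect x) \<le> 0"
  proof (rule field_le_epsilon)
    fix e :: real assume "e > 0"
    define B where "B = 2 * b * norm x"
    have B: "B \<ge> 0" using b by (simp add: B_def)
    have "norm (defect x) \<le> (e / (B + 1)) * B"
      unfolding B_def using \<open>e > 0\<close> B by (intro bound) (auto simp: B_def intro: divide_pos_pos)
    also have "\<dots> \<le> e" using \<open>e > 0\<close> B by (simp add: field_simps)
    finally show "norm (defect x) \<le> 0 + e" by simp
  qed
  then show ?thesis by simp
qed

text \<open>The defect is the commutator [T, T'] composed with T, so the commutator vanishes on the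
range of A.\<close>
lemma normal_on_complement:
  assumes x: "x \<in> orthogonal_comp (growth A 0)"
  shows "T (T' x) = T' (T x)"
proof -
  let ?P = "{x. T (T' x) = T' (T x)}"
  have "closed ?P"
    by (intro closed_Collect_eq linear_continuous_on[OF bounded_linear_compose[OF blT(1) blT(2)]]
        linear_continuous_on[OF bounded_linear_compose[OF blT(2) blT(1)]])
  moreover have "range (A ^^ 1) \<subseteq> ?P"
  proof clarify
    fix z
    obtain u v where uv: "u \<in> growth A 0" "v \<in> orthogonal_comp (growth A 0)" "z = u + v"
      using projection_theorem[OF subspace_growth[OF bounded_linear(1)] closed_growth[OF order.refl]]
      by blast
    \<comment> \<open>A annihilates u, so A z = A v, and pulling out one T writes this as T w with w
      = T^m v in the complement, where the defect vanishes.\<close>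
    obtain m where m: "n = Suc m" using n by (cases n) auto
    have "(A ^^ 1) z = A v"
      using uv linear_add[OF bounded_linear.linear[OF bounded_linear(1)]] by (simp add: growth_zero)
    also have "\<dots> = T ((T ^^ m) v)" by (simp add: m)
    finally show "T (T' ((A ^^ 1) z)) = T' (T ((A ^^ 1) z))"
      using defect_eq_0[OF complement_funpow[OF uv(2), of m]] by (simp add: defect_def)
  qed
  ultimately have "closure (range (A ^^ 1)) \<subseteq> ?P" by (rule closure_minimal[rotated])
  then show ?thesis using x complement_kernel_subset_closure_range by blast
qed

lemma kernel_nilpotent:
  assumes x: "A x = 0"
  shows "(T ^^ min n (k + 1)) x = 0"
proof (cases "n \<le> k + 1")
  case False
  \<comment> \<open>j is the excess of the exponent over k + 1. Each step applies quasiparanormality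
    at T^j x, where the right-hand side contains the factor T^(k+2+j) x = 0.\<close>
  have "(T ^^ (k + 1 + j)) x = 0 \<Longrightarrow> (T ^^ (k + 1)) x = 0" for j
  proof (induction j)
    case (Suc j)
    have "T (T ((T ^^ k) ((T ^^ j) x))) = (T ^^ (k + 1 + Suc j)) x"
      by (simp add: funpow_add)
    then have "T ((T ^^ k) ((T ^^ j) x)) = 0"
      using quasiparanormal[of "(T ^^ j) x"] Suc.prems by simp
    then show ?case using Suc.IH by (simp add: funpow_add)
  qed simp
  from this[of "n - (k + 1)"] show ?thesis using False x by simp
qed (use x in \<open>simp add: min_absorb1\<close>)

end

section \<open>The complex case\<close>

instance chilbert_space \<subseteq> banach ..

lemma cinner_scaleC_right: "cinner x (scaleC c y) = c * cinner x y"
  by (metis cinner_commute cinner_scaleC_left complex_cnj_cnj complex_cnj_mult)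

lemma scaleC_zero: "scaleC c 0 = 0"
  by (metis add_0 add_cancel_right_right scaleC_add_right)

lemma Im_cinner: "Im (cinner x y) = inner (scaleC \<i> x) y"
  by (simp add: inner_eq_Re_cinner cinner_scaleC_left)

lemma inner_scaleC_left: "inner (scaleC c x) y = inner x (scaleC (cnj c) y)"
  by (simp add: inner_eq_Re_cinner cinner_scaleC_left cinner_scaleC_right)

text \<open>The imaginary part of \<open>cinner x y\<close> is the real inner product of i x with y,
  and T commutes with multiplication by i.\<close>

lemma cinner_adjoint_iff:
  assumes "\<And>c x. T (scaleC c x) = scaleC c (T x)"
  shows "(\<forall>x y. cinner (T x) y = cinner x (S y)) \<longleftrightarrow> (\<forall>x y. inner (T x) y = inner x (S y))"
  by (auto simp: complex_eq_iff Im_cinner inner_eq_Re_cinner[symmetric] simp flip: assms)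

text \<open>Existence of a real adjoint supplies a candidate for the choice in
  \<open>cadjoint\<close>, so the chosen map really satisfies the adjoint relation.\<close>

lemma cadjoint_pair:
  fixes T :: "'a::chilbert_space \<Rightarrow> 'a"
  assumes T: "bounded_clinear T"
  shows "adjoint_pair T (cadjoint T)" "cinner (T x) y = cinner x (cadjoint T y)"
proof -
  have blT: "bounded_linear T" and T_scaleC: "\<And>c x. T (scaleC c x) = scaleC c (T x)"
    using T by (auto simp: bounded_clinear_def)
  obtain S where "adjoint_pair T S" using adjoint_pair_exists[OF blT] .
  then have "\<forall>x y. cinner (T x) y = cinner x (S y)"
    using cinner_adjoint_iff[OF T_scaleC] adjoint_pairD(3) by blast
  then have cadj: "\<forall>x y. cinner (T x) y = cinner x (cadjoint T y)"
    unfolding cadjoint_def by (rule someI[where P = "\<lambda>S. \<forall>x y. cinner (T x) y = cinner x (S y)"])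
  then show "cinner (T x) y = cinner x (cadjoint T y)" by blast
  show "adjoint_pair T (cadjoint T)"
    using cadj cinner_adjoint_iff[OF T_scaleC] by (intro adjoint_pairI[OF blT]) blast
qed

section \<open>Complex subspaces and their orthogonal complements\<close>

lemma closed_csubspaceI:
  assumes "subspace S" "closed S" "\<And>c x. x \<in> S \<Longrightarrow> scaleC c x \<in> S"
  shows "closed_csubspace S"
  using assms by (auto simp: closed_csubspace_def subspace_def)

text \<open>Multiplication by c has multiplication by \<open>cnj c\<close> as its real adjoint, so
  the real complement of a complex subspace is again complex.\<close>

lemma orthogonal_comp_scaleC:
  assumes "\<And>c x. x \<in> S \<Longrightarrow> scaleC c x \<in> S" and "x \<in> orthogonal_comp S"
  shows "scaleC c x \<in> orthogonal_comp S"
  using assms inner_scaleC_left[of "cnj c" _ x, symmetric] by (simp add: orthogonal_comp_def orthogonal_def)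

text \<open>Real orthogonality to y and to i y kills both parts of the complex inner
  product.\<close>

lemma cinner_orthogonal_comp:
  assumes "\<And>c x. x \<in> S \<Longrightarrow> scaleC c x \<in> S" and "x \<in> orthogonal_comp S" and "y \<in> S"
  shows "cinner x y = 0"
proof -
  have "cinner y x = 0"
    using assms by (auto simp: complex_eq_iff Im_cinner inner_eq_Re_cinner[symmetric]
        orthogonal_comp_def orthogonal_def)
  then show ?thesis by (metis cinner_commute complex_cnj_zero)
qed

theorem theorem6p3:
  fixes T :: "'a::chilbert_space \<Rightarrow> 'a" and k n :: nat
  assumes "bounded_clinear T"
    and "k > 0" and "n > 0"
    and "k_quasiparanormal k T"
    and "normal_op (T ^^ n)"
  shows "\<exists>H1 H2. reduces T H1 \<and> reduces T H2 \<and>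
           (\<forall>x\<in>H1. \<forall>y\<in>H2. cinner x y = 0) \<and>
           (\<forall>z. \<exists>x\<in>H1. \<exists>y\<in>H2. z = x + y) \<and>
           normal_on H1 T \<and>
           (\<forall>y\<in>H2. (T ^^ min n (k + 1)) y = 0)"
proof -
  let ?T' = "cadjoint T"
  have blT: "bounded_linear T" and T_scaleC: "\<And>c x. T (scaleC c x) = scaleC c (T x)"
    using assms(1) by (auto simp: bounded_clinear_def)
  note cadj = cadjoint_pair[OF assms(1)]
  have A_scaleC: "(T ^^ n) (scaleC c x) = scaleC c ((T ^^ n) x)" for c x
    by (rule funpow_commute_left) (rule T_scaleC)
  obtain S where S: "\<And>x y. cinner ((T ^^ n) x) y = cinner x (S y)"
    "\<And>x. (T ^^ n) (S x) = S ((T ^^ n) x)"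
    using assms(5) by (auto simp: normal_op_def normal_on_def)
  have "adjoint_pair (T ^^ n) S"
    using S(1) cinner_adjoint_iff[OF A_scaleC]
    by (intro adjoint_pairI bounded_linear_funpow blT) blast
  \<comment> \<open>\<open>normal_op\<close> only provides some map S; uniqueness of adjoints
    identifies it with the n-th power of the adjoint of T, as the locale demands.\<close>
  then have S_eq: "S = ?T' ^^ n"
    using adjoint_pair_unique[OF _ adjoint_pair_funpow[OF cadj(1)]] by blast
  interpret quasiparanormal_root T ?T' n k
    using cadj(1) assms(3,4) S(2)
    by unfold_locales (auto simp: S_eq k_quasiparanormal_def numeral_2_eq_2)
  let ?H2 = "growth (T ^^ n) 0"
  let ?H1 = "orthogonal_comp ?H2"
  have sub: "subspace ?H2" by (intro subspace_growth bounded_linear)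
  have cl: "closed ?H2" by (intro closed_growth) simp
  have H2_scaleC: "scaleC c x \<in> ?H2" if "x \<in> ?H2" for c x
    using that by (simp add: growth_zero A_scaleC scaleC_zero)
  have "reduces T ?H2"
    using closed_csubspaceI[OF sub cl H2_scaleC] growth_T growth_T' by (auto simp: reduces_def)
  moreover have "reduces T ?H1"
    using closed_csubspaceI[OF subspace_orthogonal_comp closed_orthogonal_comp
        orthogonal_comp_scaleC[OF H2_scaleC]] complement_T complement_T'
    by (auto simp: reduces_def)
  moreover have "\<forall>x\<in>?H1. \<forall>y\<in>?H2. cinner x y = 0"
    using cinner_orthogonal_comp[OF H2_scaleC] by blast
  moreover have "\<forall>z. \<exists>x\<in>?H1. \<exists>y\<in>?H2. z = x + y"
    using projection_theorem[OF sub cl] by (metis add.commute)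
  moreover have "normal_on ?H1 T"
    unfolding normal_on_def using complement_T' cadj(2) normal_on_complement by blast
  moreover have "\<forall>y\<in>?H2. (T ^^ min n (k + 1)) y = 0"
    using kernel_nilpotent by (auto simp: growth_zero)
  ultimately show ?thesis by blast
qed

end
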